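(* Let $d\ge2$, $r=1/\sqrt d$, $B_2(1)=\{x\in\mathbb R^2:\|x\|_2\le1\}$, and $$\mathcal X=\underbrace{rB_2(1)\times\cdots\times rB_2(1)}_{\lfloor d/2\rfloor\text{ times}}\times[-r,r]^{\,d-2\lfloor d/2\rfloor}\subseteq\mathbb R^d .$$ For every $T\ge16$ and every possibly randomized online algorithm $\mathcal A$ on $\mathcal X$, there is a (fixed) sequence of continuous convex losses $f_1,\dots,f_T:\mathcal X\to[0,1]$ such that $$\mathbb E_{\mathcal A}\bigl[\mathrm{Reg}_{\mathrm{Alt}}^T\bigr]\ge\frac{mK}{125},\qquad m=\min\left\{\left\lfloor\frac d2\right\rfloor,\left\lfloor\frac T{16}\right\rfloor\right\},\quad K=\left\lfloor\log_{16}\left\lfloor\frac Tm\right\rfloor\right\rfloor .$$ In particular, $\mathbb E_{\mathcal A}[\mathrm{Reg}_{\mathrm{Alt}}^T]=\Omega(d\log(1+T/d))$ with an absolute implied constant.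
   Context: A possibly randomized online algorithm $\mathcal A$ on $\mathcal X$ chooses, in each round $t\ge1$, a point $x_t\in\mathcal X$ as a (measurable) function of its internal randomness and of the past losses $f_1,\dots,f_{t-1}$; $\mathbb E_{\mathcal A}$ denotes expectation over the internal randomness of $\mathcal A$ only. With $f_0\equiv0$, $$\mathrm{Reg}_{\mathrm{Alt}}^T=\max_{u\in\mathcal X}\sum_{t=1}^T\Bigl[f_{t-1}(x_t)+f_t(x_t)-f_{t-1}(u)-f_t(u)\Bigr].$$ *)

theory Defs
  imports "HOL-Probability.Probability"
begin

text \<open>
  Since the dimension is quantified inside the statement, points of \<open>d\<close>-space are represented as
  in \<^const>\<open>Euclidean_space\<close>: functions \<^typ>\<open>nat \<Rightarrow> real\<close> that vanish at all indices \<open>\<ge> d\<close>.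
  On such points the topology of \<^typ>\<open>nat \<Rightarrow> real\<close> (pointwise convergence) is the usual one.
\<close>

type_synonym point = "nat \<Rightarrow> real"
type_synonym loss = "point \<Rightarrow> real"

definition prod_disc :: "nat \<Rightarrow> point set" where
  "prod_disc d =
     (let r = 1 / sqrt (real d) in
      {x \<in> topspace (Euclidean_space d).
         (\<forall>k < d div 2. (x (2 * k), x (2 * k + 1)) \<in> (cball 0 r :: (real \<times> real) set)) \<and>
         (\<forall>i \<in> {2 * (d div 2)..<d}. x i \<in> {-r..r})})"

text \<open>
  The type \<^typ>\<open>nat \<Rightarrow> real\<close> is not an instance of \<^class>\<open>real_vector\<close>, so \<^const>\<open>convex_on\<close>
  does not apply to functions on it.
\<close>

definition convex_fun_on :: "point set \<Rightarrow> loss \<Rightarrow> bool" where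
  "convex_fun_on X f \<longleftrightarrow>
     (\<forall>x\<in>X. \<forall>y\<in>X. \<forall>u\<in>{0..1}.
        f (\<lambda>i. (1 - u) * x i + u * y i) \<le> (1 - u) * f x + u * f y)"

text \<open>
  Using the extensional function space, each loss on \<open>X\<close> has exactly one representative, so an
  algorithm sees nothing but its values on \<open>X\<close>.
\<close>

definition losses :: "point set \<Rightarrow> loss set" where
  "losses X = {f \<in> X \<rightarrow>\<^sub>E {0..1}. continuous_on X f \<and> convex_fun_on X f}"

text \<open>
  \<open>A \<omega> [f\<^sub>1, \<dots>, f\<^bsub>t-1\<^esub>]\<close> is the point \<open>x\<^sub>t\<close> played in round \<open>t\<close>. The internal randomness is an
  arbitrary probability space; for each fixed past, the play is measurable in the randomness.
  No measurability in the losses is imposed, so every algorithm that is jointly measurable (for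
  any choice of \<open>\<sigma>\<close>-algebra on the losses) is included.
\<close>

type_synonym 'w alg = "'w \<Rightarrow> loss list \<Rightarrow> point"

definition online_algorithm :: "point set \<Rightarrow> 'w measure \<Rightarrow> 'w alg \<Rightarrow> bool" where
  "online_algorithm X M A \<longleftrightarrow>
     prob_space M \<and>
     (\<forall>fs. set fs \<subseteq> losses X \<longrightarrow> (\<lambda>\<omega>. A \<omega> fs) \<in> M \<rightarrow>\<^sub>M restrict_space borel X)"

definition play :: "'w alg \<Rightarrow> (nat \<Rightarrow> loss) \<Rightarrow> 'w \<Rightarrow> nat \<Rightarrow> point" where
  "play A f \<omega> t = A \<omega> (map f [1..<t])"

text \<open>The update \<open>f(0 := \<lambda>_. 0)\<close> implements the convention \<open>f\<^sub>0 = 0\<close>.\<close>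

definition alt_regret :: "point set \<Rightarrow> nat \<Rightarrow> (nat \<Rightarrow> loss) \<Rightarrow> (nat \<Rightarrow> point) \<Rightarrow> real" where
  "alt_regret X T f x =
     (let g = f(0 := \<lambda>_. 0) in
      SUP u\<in>X. \<Sum>t=1..T. g (t - 1) (x t) + g t (x t) - g (t - 1) u - g t u)"

definition expected_alt_regret ::
  "point set \<Rightarrow> nat \<Rightarrow> 'w measure \<Rightarrow> 'w alg \<Rightarrow> (nat \<Rightarrow> loss) \<Rightarrow> real" where
  "expected_alt_regret X T M A f = (\<integral>\<omega>. alt_regret X T f (play A f \<omega>) \<partial>M)"

definition lb_m :: "nat \<Rightarrow> nat \<Rightarrow> nat" where
  "lb_m d T = min (d div 2) (T div 16)"

definition lb_K :: "nat \<Rightarrow> nat \<Rightarrow> int" where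
  "lb_K d T = \<lfloor>log 16 (real (T div lb_m d T))\<rfloor>"

text \<open>
  The supremum in \<^const>\<open>alt_regret\<close> is a maximum on \<^term>\<open>prod_disc d\<close>, and the expectation is
  that of an integrable random variable.
\<close>

lemma prod_disc_nonempty: "prod_disc d \<noteq> {}"
proof -
  have "(\<lambda>_. 0) \<in> prod_disc d"
    by (auto simp: prod_disc_def Let_def topspace_Euclidean_space simp flip: zero_prod_def)
  then show ?thesis by blast
qed

lemma compact_prod_disc: "compact (prod_disc d)"
proof -
  define r where "r = 1 / sqrt (real d)"
  have r0: "r \<ge> 0" by (simp add: r_def)
  define B where "B = (\<Pi>\<^sub>E i\<in>UNIV. if i < d then {-r..r} else {0::real})"
  have "compactin (powertop_real UNIV) B"
    unfolding B_def by (subst compactin_PiE) auto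
  then have B: "compact B"
    by (simp add: euclidean_product_topology)
  define C where "C = (\<Inter>k\<in>{..<d div 2}. {x::point. (x (2 * k), x (2 * k + 1)) \<in> cball 0 r})"
  have "closed {x::point. (x (2 * k), x (2 * k + 1)) \<in> cball 0 r}" for k
    unfolding mem_cball_0
    by (intro closed_Collect_le continuous_on_const continuous_on_norm continuous_on_Pair
        continuous_on_product_coordinates)
  then have C: "closed C"
    unfolding C_def by (intro closed_INT) blast
  have "prod_disc d = B \<inter> C"
  proof (intro equalityI subsetI)
    fix x assume x: "x \<in> prod_disc d"
    then have z: "x i = 0" if "i \<ge> d" for i
      using that by (auto simp: prod_disc_def Let_def topspace_Euclidean_space)
    have n: "norm (x (2 * k), x (2 * k + 1)) \<le> r" if "k < d div 2" for k
      using x that by (auto simp: prod_disc_def Let_def r_def)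
    have "x i \<in> {-r..r}" if i: "i < d" for i
    proof (cases "i < 2 * (d div 2)")
      case True
      then have k: "i div 2 < d div 2" by linarith
      have "\<bar>x (2 * (i div 2))\<bar> \<le> r" "\<bar>x (2 * (i div 2) + 1)\<bar> \<le> r"
        using n[OF k] norm_fst_le[of "x (2 * (i div 2))" "x (2 * (i div 2) + 1)"]
          norm_snd_le[of "x (2 * (i div 2) + 1)" "x (2 * (i div 2))"]
        unfolding real_norm_def by linarith+
      moreover have "i = 2 * (i div 2) \<or> i = 2 * (i div 2) + 1" by linarith
      ultimately have "\<bar>x i\<bar> \<le> r" by metis
      then show ?thesis by auto
    next
      case False
      then show ?thesis using x i by (auto simp: prod_disc_def Let_def r_def)
    qed
    then show "x \<in> B \<inter> C"
      using z n by (auto simp: B_def C_def PiE_iff)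
  next
    fix x assume x: "x \<in> B \<inter> C"
    then have "x i \<in> (if i < d then {-r..r} else {0})" for i
      by (auto simp: B_def PiE_iff)
    moreover from x have "(x (2 * k), x (2 * k + 1)) \<in> cball 0 r" if "k < d div 2" for k
      using that by (auto simp: C_def)
    ultimately show "x \<in> prod_disc d"
      unfolding prod_disc_def Let_def topspace_Euclidean_space r_def[symmetric]
      by (auto, (metis atLeastAtMost_iff leD singletonD)+)
  qed
  then show ?thesis using B C by (simp add: compact_Int_closed)
qed

lemma alt_regret_attained:
  assumes f: "\<And>t. t \<in> {1..T} \<Longrightarrow> f t \<in> losses (prod_disc d)"
  defines "g \<equiv> f(0 := \<lambda>_. 0)"
  defines "R \<equiv> \<lambda>x u. \<Sum>t=1..T. g (t - 1) (x t) + g t (x t) - g (t - 1) u - g t u"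
  shows "\<exists>u\<in>prod_disc d. alt_regret (prod_disc d) T f x = R x u \<and>
           (\<forall>v\<in>prod_disc d. R x v \<le> R x u)"
proof -
  have c: "continuous_on (prod_disc d) (g t)" if "t \<le> T" for t
    using f[of t] that by (cases t) (auto simp: g_def losses_def)
  have "continuous_on (prod_disc d) (R x)"
    unfolding R_def by (intro continuous_intros c) auto
  from continuous_attains_sup[OF compact_prod_disc prod_disc_nonempty this]
  obtain u where u: "u \<in> prod_disc d" "\<forall>v\<in>prod_disc d. R x v \<le> R x u" by blast
  then have "(SUP v\<in>prod_disc d. R x v) = R x u"
    by (intro cSup_eq_maximum) auto
  then have "alt_regret (prod_disc d) T f x = R x u"
    by (simp add: alt_regret_def R_def g_def Let_def)
  with u show ?thesis by blast
qed

lemma integrable_alt_regret: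
  assumes A: "online_algorithm (prod_disc d) M A"
    and f: "\<And>t. t \<in> {1..T} \<Longrightarrow> f t \<in> losses (prod_disc d)"
  shows "integrable M (\<lambda>\<omega>. alt_regret (prod_disc d) T f (play A f \<omega>))"
proof -
  let ?X = "prod_disc d"
  interpret prob_space M using A by (simp add: online_algorithm_def)
  define g where "g = f(0 := \<lambda>_. 0)"
  define S where "S u = (\<Sum>t=1..T. g (t - 1) u + g t u)" for u
  define P where "P \<omega> = (\<Sum>t=1..T. g (t - 1) (play A f \<omega> t) + g t (play A f \<omega> t))" for \<omega>
  have c: "continuous_on ?X (g t)" and b: "\<And>y. y \<in> ?X \<Longrightarrow> norm (g t y) \<le> 1" if "t \<le> T" for t
    using f[of t] that by (cases t; auto simp: g_def losses_def PiE_iff)+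
  have pl: "(\<lambda>\<omega>. play A f \<omega> t) \<in> M \<rightarrow>\<^sub>M restrict_space borel ?X" if "t \<le> T" for t
  proof -
    have "set (map f [1..<t]) \<subseteq> losses ?X" using that f by auto
    with A show ?thesis unfolding online_algorithm_def play_def by blast
  qed
  have mg: "(\<lambda>\<omega>. g s (play A f \<omega> t)) \<in> borel_measurable M" if "s \<le> T" "t \<le> T" for s t
    using measurable_compose[OF pl[OF that(2)] borel_measurable_continuous_on_restrict[OF c[OF that(1)]]] .
  have in_X: "play A f \<omega> t \<in> ?X" if "t \<le> T" "\<omega> \<in> space M" for t \<omega>
    using measurable_space[OF pl[OF that(1)] that(2)] by (simp add: space_restrict_space)
  have ig: "integrable M (\<lambda>\<omega>. g s (play A f \<omega> t))" if "s \<le> T" "t \<le> T" for s t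
    using that by (intro integrable_const_bound[where B = 1] AE_I2 mg b in_X) auto
  have "integrable M P"
    unfolding P_def by (intro Bochner_Integration.integrable_sum Bochner_Integration.integrable_add ig) auto
  moreover have "\<exists>c. \<forall>\<omega>. alt_regret ?X T f (play A f \<omega>) = P \<omega> - c"
  proof -
    have "continuous_on ?X S"
      unfolding S_def by (intro continuous_intros c) auto
    from continuous_attains_inf[OF compact_prod_disc prod_disc_nonempty this]
    obtain u where u: "u \<in> ?X" "\<forall>v\<in>?X. S u \<le> S v" by blast
    have "alt_regret ?X T f (play A f \<omega>) = (SUP v\<in>?X. P \<omega> - S v)" for \<omega>
      by (simp add: alt_regret_def Let_def P_def S_def g_def sum.distrib sum_subtractf algebra_simps)
    also have "(SUP v\<in>?X. P \<omega> - S v) = P \<omega> - S u" for \<omega>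
      using u by (intro cSup_eq_maximum) auto
    finally show ?thesis by blast
  qed
  ultimately show ?thesis by force
qed

end

theory Submission
  imports Defs
begin

text \<open>
  All losses are hinges of linear functions of one disc, so by Jensen's inequality an algorithm may
  be replaced by its mean play, to which the adversary can react. On each disc the
  adversary keeps an arc of the boundary circle on which all losses so far vanish. In a phase with an
  arc of half-angle \<open>4\<phi>\<close> it repeats a hinge that vanishes exactly on the cap spanned by the
  arc. An algorithm that stays away from this cap pays order \<open>\<phi>\<^sup>2\<close> in each of order \<open>1/\<phi>\<^sup>2\<close> rounds;
  as soon as it comes close, a steep hinge supported on a cap of half-angle \<open>6\<phi>\<close>, centred at an end
  of the arc, costs it a constant while leaving a sub-arc of half-angle \<open>\<phi>\<close> free of loss. So every
  phase costs a constant, is \<open>16\<close> times longer than the previous one, and the comparator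
  in the surviving arcs pays nothing.
\<close>

section \<open>Hinge losses on a single disc\<close>

text \<open>The factor \<open>sqrt d\<close> rescales disc \<open>k\<close> to the unit disc; the
  value is then the inner product with the unit vector of angle \<open>w\<close>.\<close>

definition disc_coord :: "nat \<Rightarrow> nat \<Rightarrow> real \<Rightarrow> point \<Rightarrow> real" where
  "disc_coord d k w x = sqrt (real d) * (cos w * x (2 * k) + sin w * x (2 * k + 1))"

definition hinge :: "nat \<Rightarrow> nat \<Rightarrow> real \<Rightarrow> real \<Rightarrow> real \<Rightarrow> loss" where
  "hinge d k w p q = (\<lambda>x\<in>prod_disc d. max 0 (p * disc_coord d k w x + q))"

text \<open>A relation rather than a point, so that angles on several discs can be imposed on the
  same \<open>x\<close>.\<close>

definition on_circle :: "nat \<Rightarrow> nat \<Rightarrow> real \<Rightarrow> point \<Rightarrow> bool" where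
  "on_circle d k \<beta> x \<longleftrightarrow> x (2 * k) = cos \<beta> / sqrt (real d) \<and> x (2 * k + 1) = sin \<beta> / sqrt (real d)"

lemma disc_coord_on_circle:
  assumes "d > 0" "on_circle d k \<beta> x"
  shows "disc_coord d k w x = cos (\<beta> - w)"
  using assms by (simp add: disc_coord_def on_circle_def cos_diff field_simps)

lemma abs_disc_coord_le:
  assumes "d > 0" "k < d div 2" "x \<in> prod_disc d"
  shows "\<bar>disc_coord d k w x\<bar> \<le> 1"
proof -
  have "norm (x (2 * k), x (2 * k + 1)) \<le> 1 / sqrt d"
    using assms by (auto simp: prod_disc_def Let_def)
  then have n: "sqrt d * norm (x (2 * k), x (2 * k + 1)) \<le> 1"
    using assms(1) by (simp add: field_simps)
  have "\<bar>(cos w, sin w) \<bullet> (x (2 * k), x (2 * k + 1))\<bar>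
      \<le> norm (cos w, sin w) * norm (x (2 * k), x (2 * k + 1))"
    by (rule Cauchy_Schwarz_ineq2)
  then have "\<bar>cos w * x (2 * k) + sin w * x (2 * k + 1)\<bar> \<le> norm (x (2 * k), x (2 * k + 1))"
    by (simp add: norm_Pair)
  then have "sqrt d * \<bar>cos w * x (2 * k) + sin w * x (2 * k + 1)\<bar>
      \<le> sqrt d * norm (x (2 * k), x (2 * k + 1))"
    by (intro mult_left_mono) auto
  with n show ?thesis by (simp add: disc_coord_def abs_mult)
qed

lemma prod_disc_convex:
  assumes "x \<in> prod_disc d" "y \<in> prod_disc d" "u \<in> {0..1::real}"
  shows "(\<lambda>i. (1 - u) * x i + u * y i) \<in> prod_disc d"
proof -
  define r where "r = 1 / sqrt (real d)"
  have pair: "norm ((1 - u) * a + u * b, (1 - u) * a' + u * b') \<le> r"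
    if "norm (a, a') \<le> r" "norm (b, b') \<le> r" for a b a' b' :: real
  proof -
    have "(1 - u) *\<^sub>R (a, a') + u *\<^sub>R (b, b') \<in> cball 0 r"
      using that assms(3) by (intro convexD convex_cball) auto
    then show ?thesis by simp
  qed
  have single: "(1 - u) * a + u * b \<in> {-r..r}" if "a \<in> {-r..r}" "b \<in> {-r..r}" for a b :: real
    using convexD[OF convex_real_interval(5)[of "-r" r] that, of "1 - u" u] assms(3) by auto
  show ?thesis
    using assms(1,2)
    unfolding prod_disc_def Let_def r_def[symmetric] topspace_Euclidean_space
    by (auto simp del: atLeastAtMost_iff intro!: pair single)
qed

lemma continuous_on_coordinate: "continuous_on S (\<lambda>x::point. x i)"
  by (rule continuous_on_subset[OF continuous_on_product_coordinates]) auto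

text \<open>A maximum of affine functions is convex and continuous. Since \<open>disc_coord\<close>
  has absolute value at most 1, the condition on \<open>p\<close> and \<open>q\<close> keeps the
  hinge below 1.\<close>

lemma hinge_in_losses:
  assumes "d > 0" "k < d div 2" "\<bar>p\<bar> + q \<le> 1"
  shows "hinge d k w p q \<in> losses (prod_disc d)"
proof -
  have "continuous_on (prod_disc d) (hinge d k w p q)"
    unfolding hinge_def disc_coord_def
    by (rule continuous_on_cong[THEN iffD2, OF refl])
      (auto intro!: continuous_intros continuous_on_coordinate)
  moreover have "convex_fun_on (prod_disc d) (hinge d k w p q)"
    unfolding convex_fun_on_def
  proof (intro ballI)
    fix x y and u :: real
    assume *: "x \<in> prod_disc d" "y \<in> prod_disc d" "u \<in> {0..1}"
    let ?g = "\<lambda>x. p * disc_coord d k w x + q"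
    have "?g (\<lambda>i. (1 - u) * x i + u * y i) = (1 - u) * ?g x + u * ?g y"
      by (simp add: disc_coord_def algebra_simps)
    also have "\<dots> \<le> (1 - u) * max 0 (?g x) + u * max 0 (?g y)"
      using * by (intro add_mono mult_left_mono) auto
    finally have "?g (\<lambda>i. (1 - u) * x i + u * y i) \<le> (1 - u) * max 0 (?g x) + u * max 0 (?g y)" .
    moreover have "0 \<le> (1 - u) * max 0 (?g x) + u * max 0 (?g y)"
      using * by (intro add_nonneg_nonneg mult_nonneg_nonneg) auto
    ultimately show "hinge d k w p q (\<lambda>i. (1 - u) * x i + u * y i)
        \<le> (1 - u) * hinge d k w p q x + u * hinge d k w p q y"
      using * prod_disc_convex[OF *] by (simp add: hinge_def)
  qed
  moreover have "p * disc_coord d k w x + q \<le> 1" if "x \<in> prod_disc d" for x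
  proof -
    have "\<bar>p * disc_coord d k w x\<bar> \<le> \<bar>p\<bar> * 1"
      unfolding abs_mult using abs_disc_coord_le[OF assms(1,2) that] by (intro mult_left_mono) auto
    with assms(3) show ?thesis by linarith
  qed
  ultimately show ?thesis by (auto simp: losses_def hinge_def)
qed

text \<open>Zero losses serve as padding when a block or the horizon is longer than the
  construction.\<close>

lemma zero_in_losses: "(\<lambda>x\<in>prod_disc d. 0) \<in> losses (prod_disc d)"
proof -
  have "continuous_on (prod_disc d) (\<lambda>x\<in>prod_disc d. 0 :: real)"
    by (rule continuous_on_cong[THEN iffD2, OF refl, of _ _ "\<lambda>_. 0"]) auto
  moreover have "convex_fun_on (prod_disc d) (\<lambda>x\<in>prod_disc d. 0 :: real)"
    by (simp add: convex_fun_on_def prod_disc_convex)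
  ultimately show ?thesis by (auto simp: losses_def)
qed

section \<open>Trigonometric estimates for one phase\<close>

text \<open>
  Expanding in powers of \<open>z\<close> gives \<open>cos\<^sup>2 4\<phi> - cos 6\<phi> = z + 4z\<^sup>2(1 - z)(2 - z)\<close>
  and \<open>1 - cos 6\<phi> = z(3 - 2z)\<^sup>2\<close>.
\<close>

lemma cos_gap:
  fixes \<phi> :: real
  defines "z \<equiv> 1 - cos (2 * \<phi>)"
  assumes "z \<le> 1"
  shows "z \<le> cos (4 * \<phi>) * cos (4 * \<phi>) - cos (6 * \<phi>)" and "1 - cos (6 * \<phi>) \<le> 9 * z"
proof -
  have z0: "z \<ge> 0" by (simp add: z_def)
  have c: "cos (2 * \<phi>) = 1 - z" by (simp add: z_def)
  have c4: "cos (4 * \<phi>) = 2 * (1 - z)\<^sup>2 - 1"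
    using cos_double_cos[of "2 * \<phi>"] c by simp
  have c6: "cos (6 * \<phi>) = 4 * (1 - z) ^ 3 - 3 * (1 - z)"
    using cos_treble_cos[of "2 * \<phi>"] c by simp
  have "cos (4 * \<phi>) * cos (4 * \<phi>) - cos (6 * \<phi>) = z + 4 * z\<^sup>2 * ((1 - z) * (2 - z))"
    unfolding c4 c6 by (simp add: power2_eq_square power3_eq_cube algebra_simps)
  moreover have "4 * z\<^sup>2 * ((1 - z) * (2 - z)) \<ge> 0"
    using assms by (intro mult_nonneg_nonneg) auto
  ultimately show "z \<le> cos (4 * \<phi>) * cos (4 * \<phi>) - cos (6 * \<phi>)" by linarith
  have "9 * z - (1 - cos (6 * \<phi>)) = 4 * z\<^sup>2 * (3 - z)"
    unfolding c6 by (simp add: power2_eq_square power3_eq_cube algebra_simps)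
  moreover have "4 * z\<^sup>2 * (3 - z) \<ge> 0" using assms by simp
  ultimately show "1 - cos (6 * \<phi>) \<le> 9 * z" by linarith
qed

text \<open>The sign \<open>\<sigma>\<close> puts the steep hinge on the side of the arc where the play is.\<close>

lemma steep_hinge_value:
  fixes \<alpha> \<phi> a b :: real
  assumes \<phi>: "0 < \<phi>" "\<phi> \<le> pi / 8"
    and cap: "cos (4 * \<phi>) - (1 - cos (2 * \<phi>)) / 2 \<le> cos \<alpha> * a + sin \<alpha> * b"
  obtains \<sigma> :: real where "\<sigma> = 1 \<or> \<sigma> = -1"
    "1 / 18 \<le> (cos (\<alpha> - \<sigma> * (4 * \<phi>)) * a + sin (\<alpha> - \<sigma> * (4 * \<phi>)) * b - cos (6 * \<phi>)) / (1 - cos (6 * \<phi>))"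
proof -
  define z where "z = 1 - cos (2 * \<phi>)"
  \<comment> \<open>Up to sign, \<open>s\<close> is the component of \<open>(a, b)\<close>
    orthogonal to direction \<open>\<alpha>\<close>. With \<open>\<sigma>\<close> chosen by its
    sign, turning the direction by \<open>4\<phi>\<close> towards \<open>(a, b)\<close> contributes
    \<open>\<bar>s\<bar> * sin (4 * \<phi>)\<close>, which is nonnegative.\<close>
  define s where "s = sin \<alpha> * a - cos \<alpha> * b"
  define \<sigma> :: real where "\<sigma> = (if s \<ge> 0 then 1 else -1)"
  have c2: "cos (2 * \<phi>) \<ge> 0" and c4: "cos (4 * \<phi>) \<ge> 0" and s4: "sin (4 * \<phi>) \<ge> 0"
    using \<phi> by (auto intro!: cos_ge_zero sin_ge_zero)
  have z1: "z \<le> 1" using c2 by (simp add: z_def)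
  have "cos (6 * \<phi>) < cos 0"
    using \<phi> by (intro cos_monotone_0_pi) auto
  then have pos: "1 - cos (6 * \<phi>) > 0" by simp
  note gap = cos_gap[of \<phi>, folded z_def, OF z1]
  have z0: "z \<ge> 0" by (simp add: z_def)
  define y where "y = cos (\<alpha> - \<sigma> * (4 * \<phi>)) * a + sin (\<alpha> - \<sigma> * (4 * \<phi>)) * b"
  have "y =
      cos (4 * \<phi>) * (cos \<alpha> * a + sin \<alpha> * b) + \<bar>s\<bar> * sin (4 * \<phi>)"
    by (simp add: y_def \<sigma>_def s_def cos_diff sin_diff cos_add sin_add algebra_simps)
  moreover have "\<bar>s\<bar> * sin (4 * \<phi>) \<ge> 0" using s4 by simp
  moreover have "cos (4 * \<phi>) * (cos (4 * \<phi>) - z / 2) \<le> cos (4 * \<phi>) * (cos \<alpha> * a + sin \<alpha> * b)"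
    using cap c4 unfolding z_def by (intro mult_left_mono) auto
  moreover have "cos (4 * \<phi>) * (z / 2) \<le> 1 * (z / 2)"
    using z0 by (intro mult_right_mono) auto
  \<comment> \<open>The first part of \<open>cos_gap\<close> provides a margin \<open>z\<close>, and
    the slack in \<open>cap\<close> consumes at most \<open>z / 2\<close> of it. The second part
    then gives 18 = 2 * 9.\<close>
  ultimately have "z / 2 \<le> y - cos (6 * \<phi>)"
    using gap(1) by (simp add: algebra_simps)
  with gap(2) have "1 - cos (6 * \<phi>) \<le> 18 * (y - cos (6 * \<phi>))"
    by (simp add: field_simps)
  with pos have "1 / 18 \<le> (y - cos (6 * \<phi>)) / (1 - cos (6 * \<phi>))"
    by (simp add: field_simps)
  then show thesis
    unfolding y_def by (intro that[of \<sigma>]) (auto simp: \<sigma>_def)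
qed

lemma sin_four_times_le:
  fixes x :: real
  shows "\<bar>sin (4 * x)\<bar> \<le> 4 * \<bar>sin x\<bar>"
proof -
  have "\<bar>sin (2 * y)\<bar> \<le> 2 * \<bar>sin y\<bar>" for y :: real
    using mult_left_mono[OF abs_cos_le_one, of "2 * \<bar>sin y\<bar>" y]
    by (simp add: sin_double abs_mult)
  from this[of x] this[of "2 * x"] show ?thesis by simp
qed

text \<open>Quartering the angle divides the squared sine by at most 16, which the factor
  \<open>16 ^ n\<close> compensates. The right-hand side is the total cost of
  \<open>15 * 16 ^ n\<close> rounds that each cost a quarter of
  \<open>1 - cos (2 * \<phi>)\<close>.\<close>

lemma phase_length_suffices:
  "1 / 125 \<le> real (15 * 16 ^ n) * (1 - cos (2 * (pi / 8 / 4 ^ n))) / 4"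
proof -
  \<comment> \<open>The start uses \<open>sin (pi / 2) = 1\<close>. The constant 1/64 is generous:
    15 * 2 / (4 * 64) exceeds 1/125.\<close>
  have *: "1 / 64 \<le> 16 ^ n * (sin (pi / 8 / 4 ^ n))\<^sup>2"
  proof (induction n)
    case 0
    have "1 \<le> 4 * \<bar>sin (pi / 8)\<bar>"
      using sin_four_times_le[of "pi / 8"] by simp
    then have "1\<^sup>2 \<le> (4 * \<bar>sin (pi / 8)\<bar>)\<^sup>2" by (intro power_mono) auto
    then show ?case by (simp add: power_mult_distrib)
  next
    case (Suc n)
    have "\<bar>sin (pi / 8 / 4 ^ n)\<bar>\<^sup>2 \<le> (4 * \<bar>sin (pi / 8 / 4 ^ Suc n)\<bar>)\<^sup>2"
      using sin_four_times_le[of "pi / 8 / 4 ^ Suc n"] by (intro power_mono) auto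
    then have "(sin (pi / 8 / 4 ^ n))\<^sup>2 \<le> 16 * (sin (pi / 8 / 4 ^ Suc n))\<^sup>2"
      by (simp add: power_mult_distrib)
    then have "16 ^ n * (sin (pi / 8 / 4 ^ n))\<^sup>2 \<le> 16 ^ n * (16 * (sin (pi / 8 / 4 ^ Suc n))\<^sup>2)"
      by (intro mult_left_mono) auto
    also have "\<dots> = 16 ^ Suc n * (sin (pi / 8 / 4 ^ Suc n))\<^sup>2" by simp
    finally show ?case using Suc by linarith
  qed
  have "1 - cos (2 * y) = 2 * (sin y)\<^sup>2" for y :: real
    by (simp add: cos_double_sin)
  from this[of "pi / 8 / 4 ^ n"] * show ?thesis by simp
qed

section \<open>Expected losses of a fixed algorithm\<close>

locale learner =
  fixes d :: nat and M :: "'w measure" and A :: "'w alg"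
  assumes d: "d > 0"
    and alg: "online_algorithm (prod_disc d) M A"
begin

abbreviation X :: "point set" where "X \<equiv> prod_disc d"

sublocale prob_space M
  using alg by (simp add: online_algorithm_def)

text \<open>The expected loss on \<open>gs\<close> after the past \<open>fs\<close>. Only the terms
  \<open>f t (x t)\<close> of the alternating regret are counted; the terms
  \<open>f (t - 1) (x t)\<close> are nonnegative and are dropped at the end.\<close>

primrec cost :: "loss list \<Rightarrow> loss list \<Rightarrow> real" where
  "cost fs [] = 0"
| "cost fs (g # gs) = (\<integral>\<omega>. g (A \<omega> fs) \<partial>M) + cost (fs @ [g]) gs"

lemma cost_append: "cost fs (gs @ hs) = cost fs gs + cost (fs @ gs) hs"
  by (induction gs arbitrary: fs) auto

lemma cost_eq_sum: "cost fs gs = (\<Sum>i<length gs. \<integral>\<omega>. (gs ! i) (A \<omega> (fs @ take i gs)) \<partial>M)"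
  by (induction gs arbitrary: fs) (simp_all add: sum.lessThan_Suc_shift del: sum.lessThan_Suc)

lemma play_measurable: "set fs \<subseteq> losses X \<Longrightarrow> (\<lambda>\<omega>. A \<omega> fs) \<in> M \<rightarrow>\<^sub>M restrict_space borel X"
  using alg by (simp add: online_algorithm_def)

lemma play_in_X: "set fs \<subseteq> losses X \<Longrightarrow> \<omega> \<in> space M \<Longrightarrow> A \<omega> fs \<in> X"
  using measurable_space[OF play_measurable] by (simp add: space_restrict_space)

lemma integrable_play:
  fixes g :: "point \<Rightarrow> real"
  assumes fs: "set fs \<subseteq> losses X" and g: "continuous_on X g"
  shows "integrable M (\<lambda>\<omega>. g (A \<omega> fs))"
proof -
  have "bounded (g ` X)"
    using compact_continuous_image[OF g compact_prod_disc] by (rule compact_imp_bounded)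
  then obtain B where "\<And>x. x \<in> X \<Longrightarrow> norm (g x) \<le> B"
    unfolding bounded_iff by auto
  then show ?thesis
    using measurable_compose[OF play_measurable[OF fs] borel_measurable_continuous_on_restrict[OF g]]
    by (intro integrable_const_bound[where B = B] AE_I2) (auto intro: play_in_X[OF fs])
qed

lemma integral_loss_nonneg:
  assumes "set fs \<subseteq> losses X" "g \<in> losses X"
  shows "0 \<le> (\<integral>\<omega>. g (A \<omega> fs) \<partial>M)"
proof (rule Bochner_Integration.integral_nonneg)
  fix \<omega> assume "\<omega> \<in> space M"
  then have "A \<omega> fs \<in> X" by (rule play_in_X[OF assms(1)])
  then show "0 \<le> g (A \<omega> fs)" using assms(2) by (auto simp: losses_def PiE_iff)
qed

lemma cost_nonneg: "set fs \<subseteq> losses X \<Longrightarrow> set gs \<subseteq> losses X \<Longrightarrow> 0 \<le> cost fs gs"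
  by (induction gs arbitrary: fs) (auto intro!: add_nonneg_nonneg integral_loss_nonneg)

text \<open>Determined by the past losses alone, so losses chosen with its help still form a fixed
  sequence, independent of the randomness.\<close>

definition mean_play :: "loss list \<Rightarrow> point" where
  "mean_play fs = (\<lambda>i. \<integral>\<omega>. A \<omega> fs i \<partial>M)"

text \<open>Jensen's inequality for a hinge: expectation commutes with the affine part, and the
  hinge dominates it.\<close>

lemma hinge_mean_play_le:
  assumes fs: "set fs \<subseteq> losses X"
  shows "p * disc_coord d k w (mean_play fs) + q \<le> (\<integral>\<omega>. hinge d k w p q (A \<omega> fs) \<partial>M)"
proof -
  have i: "integrable M (\<lambda>\<omega>. A \<omega> fs i)" for i
    using integrable_play[OF fs, of "\<lambda>x. x i"]
    by (simp add: continuous_on_coordinate)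
  have c: "continuous_on X (\<lambda>x. p * disc_coord d k w x + q)"
    unfolding disc_coord_def by (intro continuous_intros continuous_on_coordinate)
  then have "continuous_on X (\<lambda>x. max 0 (p * disc_coord d k w x + q))"
    by (intro continuous_on_max continuous_on_const)
  then have "continuous_on X (hinge d k w p q)"
    unfolding hinge_def by (rule continuous_on_cong[THEN iffD2, OF refl, rotated]) auto
  note ih = integrable_play[OF fs this]
  have "p * disc_coord d k w (mean_play fs) + q = (\<integral>\<omega>. p * disc_coord d k w (A \<omega> fs) + q \<partial>M)"
    using i by (simp add: disc_coord_def mean_play_def prob_space)
  also have "\<dots> \<le> (\<integral>\<omega>. hinge d k w p q (A \<omega> fs) \<partial>M)"
    using play_in_X[OF fs] by (intro integral_mono integrable_play[OF fs c] ih) (auto simp: hinge_def)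
  finally show ?thesis .
qed

section \<open>The adversary: one phase, one disc, all discs\<close>

text \<open>Both outcomes use exactly \<open>n\<close> rounds, so the schedule does not depend on
  the algorithm. The new arc lies in the old one of half-angle \<open>4\<phi>\<close>, as its centre
  moves by \<open>3\<phi>\<close>.\<close>

lemma phase:
  assumes fs: "set fs \<subseteq> losses X" and k: "k < d div 2"
    and \<phi>: "0 < \<phi>" "\<phi> \<le> pi / 8"
    and n: "1 / 125 \<le> real n * (1 - cos (2 * \<phi>)) / 4"
  obtains gs \<alpha>' where "length gs = n" "set gs \<subseteq> losses X" "1 / 125 \<le> cost fs gs"
    "\<bar>\<alpha>' - \<alpha>\<bar> = 3 * \<phi>"
    "\<And>g x \<beta>. g \<in> set gs \<Longrightarrow> x \<in> X \<Longrightarrow> on_circle d k \<beta> x \<Longrightarrow> \<bar>\<beta> - \<alpha>'\<bar> \<le> \<phi> \<Longrightarrow> g x = 0"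
proof -
  \<comment> \<open>Zero exactly on the cap over the arc of half-angle \<open>4\<phi>\<close>; slope
    1/2 keeps the values at most 1.\<close>
  define push where "push = hinge d k \<alpha> (- 1 / 2) (cos (4 * \<phi>) / 2)"
  have pl: "push \<in> losses X"
    unfolding push_def by (rule hinge_in_losses[OF d k]) (simp add: field_simps)
  have push0: "push x = 0" if "x \<in> X" "on_circle d k \<beta> x" "\<bar>\<beta> - \<alpha>\<bar> \<le> 4 * \<phi>" for x \<beta>
  proof -
    have "cos (4 * \<phi>) \<le> cos \<bar>\<beta> - \<alpha>\<bar>"
      using that(3) \<phi> by (intro cos_monotone_0_pi_le) auto
    then show ?thesis
      using that by (simp add: push_def hinge_def disc_coord_on_circle[OF d])
  qed
  let ?past = "\<lambda>i. fs @ replicate i push"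
  have past: "set (?past i) \<subseteq> losses X" for i using fs pl by auto
  show thesis
  \<comment> \<open>The question is whether some mean play comes within
    \<open>(1 - cos (2 * \<phi>)) / 2\<close> of the cap. If not, slope 1/2 makes every round cost
    half that distance.\<close>
  proof (cases "\<exists>i<n. cos (4 * \<phi>) - (1 - cos (2 * \<phi>)) / 2 \<le> disc_coord d k \<alpha> (mean_play (?past i))")
    case True
    then obtain i where i: "i < n"
      and cap: "cos (4 * \<phi>) - (1 - cos (2 * \<phi>)) / 2 \<le> disc_coord d k \<alpha> (mean_play (?past i))"
      by blast
    let ?b = "cos (6 * \<phi>)"
    have "?b < cos 0" using \<phi> by (intro cos_monotone_0_pi) auto
    then have pos: "1 - ?b > 0" by simp
    from steep_hinge_value[OF \<phi>, of \<alpha> "sqrt d * mean_play (?past i) (2 * k)"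
        "sqrt d * mean_play (?past i) (2 * k + 1)"] cap
    obtain \<sigma> :: real where \<sigma>: "\<sigma> = 1 \<or> \<sigma> = -1"
      and val: "1 / 18 \<le> (disc_coord d k (\<alpha> - \<sigma> * (4 * \<phi>)) (mean_play (?past i)) - ?b) / (1 - ?b)"
      by (auto simp: disc_coord_def algebra_simps)
    \<comment> \<open>Value 1 at the boundary point of angle
      \<open>\<alpha> - \<sigma> * (4 * \<phi>)\<close>, falling to zero at the edge of the cap of
      half-angle \<open>6\<phi>\<close> around it.\<close>
    define steep where "steep = hinge d k (\<alpha> - \<sigma> * (4 * \<phi>)) (1 / (1 - ?b)) (- ?b / (1 - ?b))"
    have sl: "steep \<in> losses X"
      unfolding steep_def using pos by (intro hinge_in_losses[OF d k]) (simp add: field_simps)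
    note val
    also have "(disc_coord d k (\<alpha> - \<sigma> * (4 * \<phi>)) (mean_play (?past i)) - ?b) / (1 - ?b)
        = 1 / (1 - ?b) * disc_coord d k (\<alpha> - \<sigma> * (4 * \<phi>)) (mean_play (?past i)) + (- ?b / (1 - ?b))"
      by (simp add: diff_divide_distrib)
    also have "\<dots> \<le> (\<integral>\<omega>. steep (A \<omega> (?past i)) \<partial>M)"
      unfolding steep_def by (rule hinge_mean_play_le[OF past])
    finally have step: "1 / 125 \<le> cost (?past i) [steep]" by simp
    have steep0: "steep x = 0"
      if "x \<in> X" "on_circle d k \<beta> x" "\<bar>\<beta> - (\<alpha> + \<sigma> * (3 * \<phi>))\<bar> \<le> \<phi>" for x \<beta>
    proof -
      \<comment> \<open>The new arc is centred at distance \<open>7\<phi>\<close> from the centre of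
        the steep cap, so its angles are between \<open>6\<phi>\<close> and \<open>8\<phi>\<close>
        away, and \<open>8\<phi>\<close> is at most \<open>pi\<close>.\<close>
      have "cos \<bar>\<beta> - (\<alpha> - \<sigma> * (4 * \<phi>))\<bar> \<le> ?b"
        using that(3) \<phi> \<sigma> by (intro cos_monotone_0_pi_le) auto
      then have "cos (\<beta> - (\<alpha> - \<sigma> * (4 * \<phi>))) / (1 - ?b) \<le> ?b / (1 - ?b)"
        using pos by (intro divide_right_mono) auto
      then show ?thesis
        using that by (simp add: steep_def hinge_def disc_coord_on_circle[OF d])
    qed
    \<comment> \<open>The steep hinge replaces the push in round \<open>i\<close>, where the past is
      exactly \<open>?past i\<close>; further pushes fill up the phase.\<close>
    let ?gs = "replicate i push @ [steep] @ replicate (n - Suc i) push"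
    show thesis
    proof (rule that[of ?gs "\<alpha> + \<sigma> * (3 * \<phi>)"])
      show "length ?gs = n" using i by simp
      show "set ?gs \<subseteq> losses X" using pl sl by auto
      have "cost fs ?gs = cost fs (replicate i push) + (cost (?past i) [steep]
          + cost (?past i @ [steep]) (replicate (n - Suc i) push))"
        by (simp only: cost_append)
      moreover have "cost fs (replicate i push) \<ge> 0"
        "cost (?past i @ [steep]) (replicate (n - Suc i) push) \<ge> 0"
        using pl sl fs by (auto intro!: cost_nonneg)
      ultimately show "1 / 125 \<le> cost fs ?gs" using step by linarith
      show "\<bar>\<alpha> + \<sigma> * (3 * \<phi>) - \<alpha>\<bar> = 3 * \<phi>" using \<sigma> \<phi> by auto
      fix g x \<beta> assume g: "g \<in> set ?gs" and x: "x \<in> X" "on_circle d k \<beta> x"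
        and \<beta>: "\<bar>\<beta> - (\<alpha> + \<sigma> * (3 * \<phi>))\<bar> \<le> \<phi>"
      from \<beta> \<sigma> \<phi> have "\<bar>\<beta> - \<alpha>\<bar> \<le> 4 * \<phi>" by auto
      then show "g x = 0" using g push0[OF x] steep0[OF x \<beta>] by auto
    qed
  next
    case False
    have "(1 - cos (2 * \<phi>)) / 4 \<le> (\<integral>\<omega>. push (A \<omega> (?past i)) \<partial>M)" if "i < n" for i
    proof -
      have "disc_coord d k \<alpha> (mean_play (?past i)) < cos (4 * \<phi>) - (1 - cos (2 * \<phi>)) / 2"
        using False that by (meson not_le)
      then have "(1 - cos (2 * \<phi>)) / 4
          \<le> - 1 / 2 * disc_coord d k \<alpha> (mean_play (?past i)) + cos (4 * \<phi>) / 2"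
        by (simp add: field_simps)
      also have "\<dots> \<le> (\<integral>\<omega>. push (A \<omega> (?past i)) \<partial>M)"
        unfolding push_def by (rule hinge_mean_play_le[OF past[unfolded push_def]])
      finally show ?thesis .
    qed
    then have "(\<Sum>i<n. (1 - cos (2 * \<phi>)) / 4) \<le> (\<Sum>i<n. \<integral>\<omega>. push (A \<omega> (?past i)) \<partial>M)"
      by (intro sum_mono) auto
    also have "\<dots> = cost fs (replicate n push)"
      unfolding cost_eq_sum by (auto intro!: sum.cong simp: min_absorb1)
    finally have "(\<Sum>i<n. (1 - cos (2 * \<phi>)) / 4) \<le> cost fs (replicate n push)" .
    with n have "1 / 125 \<le> cost fs (replicate n push)" by simp
    \<comment> \<open>The whole arc is still free of loss; the sub-arc shifted by
      \<open>3\<phi>\<close> is one valid choice.\<close>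
    then show thesis
      using \<phi> pl push0 by (intro that[of "replicate n push" "\<alpha> + 3 * \<phi>"]) auto
  qed
qed

text \<open>Phase \<open>K\<close> takes \<open>15 * 16 ^ K\<close> rounds, and these lengths sum to
  \<open>16 ^ K - 1\<close>. The first arc is a half circle, and each phase leaves a quarter of the
  previous half-angle.\<close>

lemma phases:
  assumes fs: "set fs \<subseteq> losses X" and k: "k < d div 2"
  shows "\<exists>gs \<alpha>. length gs = 16 ^ K - 1 \<and> set gs \<subseteq> losses X \<and> real K / 125 \<le> cost fs gs \<and>
    (\<forall>g\<in>set gs. \<forall>x\<in>X. \<forall>\<beta>. on_circle d k \<beta> x \<longrightarrow> \<bar>\<beta> - \<alpha>\<bar> \<le> 4 * (pi / 8 / 4 ^ K) \<longrightarrow> g x = 0)"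
proof (induction K)
  case 0
  show ?case by (intro exI[of _ "[]"]) simp
next
  case (Suc K)
  let ?\<phi> = "pi / 8 / 4 ^ K :: real"
  from Suc obtain gs \<alpha> where gs: "length gs = 16 ^ K - 1" "set gs \<subseteq> losses X" "real K / 125 \<le> cost fs gs"
    and z: "\<And>g x \<beta>. g \<in> set gs \<Longrightarrow> x \<in> X \<Longrightarrow> on_circle d k \<beta> x \<Longrightarrow> \<bar>\<beta> - \<alpha>\<bar> \<le> 4 * ?\<phi> \<Longrightarrow> g x = 0"
    by metis
  have "?\<phi> \<le> pi / 8 / 1" by (intro divide_left_mono) auto
  then have \<phi>: "0 < ?\<phi>" "?\<phi> \<le> pi / 8" by auto
  have "set (fs @ gs) \<subseteq> losses X" using fs gs by auto
  from phase[OF this k \<phi> phase_length_suffices, of \<alpha>] obtain hs \<alpha>' where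
    hs: "length hs = 15 * 16 ^ K" "set hs \<subseteq> losses X" "1 / 125 \<le> cost (fs @ gs) hs"
    and \<alpha>': "\<bar>\<alpha>' - \<alpha>\<bar> = 3 * ?\<phi>"
    and z': "\<And>g x \<beta>. g \<in> set hs \<Longrightarrow> x \<in> X \<Longrightarrow> on_circle d k \<beta> x \<Longrightarrow> \<bar>\<beta> - \<alpha>'\<bar> \<le> ?\<phi> \<Longrightarrow> g x = 0"
    by metis
  have 4: "4 * (pi / 8 / 4 ^ Suc K) = ?\<phi>" by simp
  have "g x = 0" if "g \<in> set (gs @ hs)" "x \<in> X" "on_circle d k \<beta> x" "\<bar>\<beta> - \<alpha>'\<bar> \<le> ?\<phi>" for g x \<beta>
  proof -
    have "\<bar>\<beta> - \<alpha>\<bar> \<le> 4 * ?\<phi>" using that(4) \<alpha>' by linarith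
    with that show ?thesis using z z' by auto
  qed
  moreover have "length (gs @ hs) = 16 ^ Suc K - 1" using gs hs by simp
  moreover have "real (Suc K) / 125 \<le> cost fs (gs @ hs)"
    using gs(3) hs(3) by (simp add: cost_append add_divide_distrib)
  ultimately show ?case
    using gs(2) hs(2) unfolding 4 by (intro exI[of _ "gs @ hs"] exI[of _ \<alpha>']) auto
qed

text \<open>The discs are attacked one after another, each with a fresh half circle. A block
  constrains the comparator only on its own disc, so the constraints never conflict.\<close>

lemma blocks:
  assumes N: "16 ^ K \<le> N" and j: "j \<le> d div 2"
  shows "\<exists>gs \<alpha>. length gs = j * N \<and> set gs \<subseteq> losses X \<and> real j * real K / 125 \<le> cost [] gs \<and>
    (\<forall>g\<in>set gs. \<forall>x\<in>X. (\<forall>k<j. on_circle d k (\<alpha> k) x) \<longrightarrow> g x = 0)"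
  using j
proof (induction j)
  case 0
  show ?case by (intro exI[of _ "[]"]) simp
next
  case (Suc j)
  from Suc obtain gs \<alpha> where gs: "length gs = j * N" "set gs \<subseteq> losses X"
      "real j * real K / 125 \<le> cost [] gs"
    and z: "\<And>g x. g \<in> set gs \<Longrightarrow> x \<in> X \<Longrightarrow> \<forall>k<j. on_circle d k (\<alpha> k) x \<Longrightarrow> g x = 0"
    by (metis Suc_leD)
  have j: "j < d div 2" using Suc.prems by simp
  from phases[OF gs(2) j, of K] obtain hs \<alpha>' where
    hs: "length hs = 16 ^ K - 1" "set hs \<subseteq> losses X" "real K / 125 \<le> cost gs hs"
    and "\<forall>g\<in>set hs. \<forall>x\<in>X. \<forall>\<beta>. on_circle d j \<beta> x \<longrightarrow> \<bar>\<beta> - \<alpha>'\<bar> \<le> 4 * (pi / 8 / 4 ^ K) \<longrightarrow> g x = 0"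
    by blast
  \<comment> \<open>From here on only the centre of the surviving arc is kept.\<close>
  then have z': "\<And>g x. g \<in> set hs \<Longrightarrow> x \<in> X \<Longrightarrow> on_circle d j \<alpha>' x \<Longrightarrow> g x = 0"
    by auto
  let ?ps = "replicate (N - (16 ^ K - 1)) (\<lambda>x\<in>X. 0 :: real)"
  have ps: "set ?ps \<subseteq> losses X" using zero_in_losses by auto
  have "set (gs @ hs) \<subseteq> losses X" using gs hs by auto
  from cost_nonneg[OF this ps] have "real (Suc j) * real K / 125 \<le> cost [] (gs @ hs @ ?ps)"
    using gs(3) hs(3) by (simp add: cost_append add_divide_distrib algebra_simps)
  moreover have "length (gs @ hs @ ?ps) = Suc j * N" using gs(1) hs(1) N by simp
  moreover have "g x = 0"
    if "g \<in> set (gs @ hs @ ?ps)" "x \<in> X" "\<forall>k<Suc j. on_circle d k ((\<alpha>(j := \<alpha>')) k) x" for g x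
  proof -
    have "\<forall>k<j. on_circle d k (\<alpha> k) x" using that(3) by (auto simp: less_Suc_eq)
    moreover have "on_circle d j \<alpha>' x" using that(3) by auto
    ultimately show ?thesis using that(1,2) z z' by auto
  qed
  ultimately show ?case
    using gs(2) hs(2) ps by (intro exI[of _ "gs @ hs @ ?ps"] exI[of _ "\<alpha>(j := \<alpha>')"]) auto
qed

section \<open>The comparator and the regret\<close>

text \<open>The discs use disjoint coordinates, so their angles can be prescribed independently; for
  odd \<open>d\<close> the last coordinate is set to 0.\<close>

lemma circles_meet_prod_disc: "\<exists>x\<in>X. \<forall>k<d div 2. on_circle d k (\<alpha> k) x"
proof
  define x :: point where "x = (\<lambda>i. if i < 2 * (d div 2) then
      (if even i then cos (\<alpha> (i div 2)) else sin (\<alpha> (i div 2))) / sqrt d else 0)"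
  show c: "\<forall>k<d div 2. on_circle d k (\<alpha> k) x"
    by (auto simp: x_def on_circle_def)
  have "norm (cos \<beta> / sqrt d, sin \<beta> / sqrt d) = 1 / sqrt d" for \<beta>
  proof -
    have "norm ((1 / sqrt d) *\<^sub>R (cos \<beta>, sin \<beta>)) = 1 / sqrt d"
      unfolding norm_scaleR by (simp add: norm_Pair)
    then show ?thesis by simp
  qed
  then show "x \<in> X"
    using c unfolding prod_disc_def Let_def topspace_Euclidean_space
    by (auto simp: on_circle_def x_def)
qed

text \<open>The comparator \<open>u\<close> pays nothing, so the regret is at least the sum of all
  losses of the plays, of which the nonnegative terms \<open>f (t - 1) (x t)\<close> are
  discarded.\<close>

lemma cost_le_expected_alt_regret:
  assumes f: "\<And>t. t \<in> {1..T} \<Longrightarrow> f t \<in> losses X"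
    and u: "u \<in> X" "\<And>t. t \<in> {1..T} \<Longrightarrow> f t u = 0"
  shows "cost [] (map f [1..<Suc T]) \<le> expected_alt_regret X T M A f"
proof -
  have past: "set (map f [1..<t]) \<subseteq> losses X" if "t \<le> T" for t
    using f that by auto
  have play: "play A f \<omega> t \<in> X" if "t \<le> T" "\<omega> \<in> space M" for t \<omega>
    unfolding play_def by (rule play_in_X[OF past[OF that(1)] that(2)])
  have int: "integrable M (\<lambda>\<omega>. f t (play A f \<omega> t))" if "t \<in> {1..T}" for t
    using that f[OF that] past[of t] unfolding play_def
    by (intro integrable_play) (auto simp: losses_def)
  have le: "(\<Sum>t=1..T. f t (play A f \<omega> t)) \<le> alt_regret X T f (play A f \<omega>)"
    if \<omega>: "\<omega> \<in> space M" for \<omega>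
  proof -
    let ?g = "f(0 := \<lambda>_. 0)"
    let ?x = "play A f \<omega>"
    let ?R = "\<lambda>u. \<Sum>t=1..T. ?g (t - 1) (?x t) + ?g t (?x t) - ?g (t - 1) u - ?g t u"
    from alt_regret_attained[where T = T and f = f and x = ?x, OF f] have "?R u \<le> alt_regret X T f ?x"
      using u(1) by auto
    moreover have "(\<Sum>t=1..T. f t (?x t)) \<le> ?R u"
    proof (rule sum_mono)
      fix t assume t: "t \<in> {1..T}"
      have "?g (t - 1) (?x t) \<ge> 0 \<and> ?g (t - 1) u = 0"
      \<comment> \<open>For \<open>t = 1\<close> the previous loss is the conventional zero
        function, which need not be among the losses given by \<open>f\<close>.\<close>
      proof (cases "t = 1")
        case False
        then have t': "t - 1 \<in> {1..T}" using t by auto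
        then show ?thesis
          using f[OF t'] u(2)[OF t'] play[OF _ \<omega>, of t] t by (auto simp: losses_def PiE_iff)
      qed simp
      then show "f t (?x t) \<le> ?g (t - 1) (?x t) + ?g t (?x t) - ?g (t - 1) u - ?g t u"
        using u(2)[OF t] t by auto
    qed
    ultimately show ?thesis by linarith
  qed
  have "cost [] (map f [1..<Suc T]) = (\<Sum>i<T. \<integral>\<omega>. f (Suc i) (play A f \<omega> (Suc i)) \<partial>M)"
    unfolding cost_eq_sum play_def
    by (auto intro!: sum.cong simp: take_map min_absorb1 simp del: upt_Suc)
  also have "\<dots> = (\<Sum>t=1..T. \<integral>\<omega>. f t (play A f \<omega> t) \<partial>M)"
    by (rule sum.reindex_bij_witness[of _ "\<lambda>t. t - 1" Suc]) auto
  also have "\<dots> = (\<integral>\<omega>. (\<Sum>t=1..T. f t (play A f \<omega> t)) \<partial>M)"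
    using int by (simp add: Bochner_Integration.integral_sum)
  also have "\<dots> \<le> expected_alt_regret X T M A f"
    unfolding expected_alt_regret_def
    using int le integrable_alt_regret[OF alg f]
    by (intro integral_mono Bochner_Integration.integrable_sum) auto
  finally show ?thesis .
qed

lemma regret_lower_bound:
  assumes N: "16 ^ K \<le> N" and m: "m \<le> d div 2" and T: "m * N \<le> T"
  shows "\<exists>f. (\<forall>t\<in>{1..T}. f t \<in> losses X) \<and>
    real m * real K / 125 \<le> expected_alt_regret X T M A f"
proof -
  from blocks[OF N m] obtain gs \<alpha> where gs: "length gs = m * N" "set gs \<subseteq> losses X"
      "real m * real K / 125 \<le> cost [] gs"
    and z: "\<And>g x. g \<in> set gs \<Longrightarrow> x \<in> X \<Longrightarrow> \<forall>k<m. on_circle d k (\<alpha> k) x \<Longrightarrow> g x = 0"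
    by metis
  define hs where "hs = gs @ replicate (T - m * N) (\<lambda>x\<in>X. 0 :: real)"
  \<comment> \<open>Rounds count from 1, list positions from 0; \<open>alt_regret\<close> overwrites
    the value at 0.\<close>
  define f where "f t = hs ! (t - 1)" for t
  have len: "length hs = T" using gs(1) T by (simp add: hs_def)
  have hs: "set hs \<subseteq> losses X" using gs(2) zero_in_losses by (auto simp: hs_def)
  have mem: "f t \<in> set hs" if "t \<in> {1..T}" for t
    using that len by (auto simp: f_def)
  obtain u where u: "u \<in> X" "\<forall>k<d div 2. on_circle d k (\<alpha> k) u"
    using circles_meet_prod_disc by blast
  have "g u = 0" if "g \<in> set hs" for g
    using that u z[of g u] m by (auto simp: hs_def)
  then have "cost [] (map f [1..<Suc T]) \<le> expected_alt_regret X T M A f"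
    using mem hs u(1) by (intro cost_le_expected_alt_regret) blast+
  moreover have "map f [1..<Suc T] = hs"
    using len by (intro nth_equalityI) (auto simp: f_def simp del: upt_Suc)
  moreover have "cost [] gs \<le> cost [] hs"
    unfolding hs_def cost_append using gs(2) zero_in_losses by (auto intro!: cost_nonneg)
  ultimately have "real m * real K / 125 \<le> expected_alt_regret X T M A f"
    using gs(3) by simp
  with mem hs show ?thesis by blast
qed

end

section \<open>Arithmetic of \<open>m\<close> and \<open>K\<close>, and the logarithmic rate\<close>

lemma lb_m_bounds:
  assumes "d \<ge> 2" "T \<ge> 16"
  shows "lb_m d T \<ge> 1" "lb_m d T \<le> d div 2" "T div lb_m d T \<ge> 16" "lb_m d T * (T div lb_m d T) \<le> T"
proof -
  show 1: "lb_m d T \<ge> 1" "lb_m d T \<le> d div 2" using assms by (auto simp: lb_m_def)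
  have "lb_m d T * 16 \<le> T" by (simp add: lb_m_def)
  then show "T div lb_m d T \<ge> 16" using 1 by (simp add: less_eq_div_iff_mult_less_eq mult.commute)
  show "lb_m d T * (T div lb_m d T) \<le> T" by simp
qed

lemma lb_K_bounds:
  assumes "d \<ge> 2" "T \<ge> 16"
  shows "lb_K d T \<ge> 1" "16 ^ nat (lb_K d T) \<le> T div lb_m d T"
    "ln (real (T div lb_m d T)) \<le> 8 * of_int (lb_K d T)"
proof -
  let ?N = "T div lb_m d T"
  have N: "?N \<ge> 16" using lb_m_bounds[OF assms] by simp
  then have "log 16 16 \<le> log 16 (real ?N)" by (subst log_le_cancel_iff) auto
  then show 1: "lb_K d T \<ge> 1" by (simp add: lb_K_def le_floor_iff)
  have "16 powr of_int (lb_K d T) \<le> 16 powr log 16 (real ?N)"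
    unfolding lb_K_def by (intro powr_mono) auto
  also have "\<dots> = real ?N" using N by (subst powr_log_cancel) auto
  finally have "real (16 ^ nat (lb_K d T)) \<le> real ?N"
    using 1 by (simp add: powr_real_of_int)
  then show "16 ^ nat (lb_K d T) \<le> ?N" by linarith
  have "ln (16 :: real) = 4 * ln 2" using ln_realpow[of 2 4] by simp
  also have "\<dots> \<le> 4" using ln_less_self[of "2 :: real"] ln_add_one_self_le_self[of "1 :: real"] by simp
  finally have ln16: "ln (16 :: real) \<le> 4" .
  have "ln (real ?N) = log 16 (real ?N) * ln 16" by (simp add: log_def)
  \<comment> \<open>As \<open>lb_K\<close> is at least 1, rounding down the logarithm loses at most
    a factor 2.\<close>
  also have "\<dots> \<le> (2 * of_int (lb_K d T)) * 4"
  proof (intro mult_mono ln16)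
    have "log 16 (real ?N) < of_int (lb_K d T) + 1" unfolding lb_K_def by linarith
    with 1 show "log 16 (real ?N) \<le> 2 * of_int (lb_K d T)" by linarith
  qed (use 1 in auto)
  finally show "ln (real ?N) \<le> 8 * of_int (lb_K d T)" by simp
qed

text \<open>If \<open>m = d div 2\<close>, then \<open>d \<le> 3 * m\<close> and the logarithm is at
  most \<open>8 * K\<close>, giving the factor 24. Otherwise \<open>m = T div 16\<close>, and
  \<open>ln (1 + x) \<le> x\<close> bounds the left side by \<open>T\<close>, hence by
  \<open>32 * m\<close>.\<close>

lemma ln_rate_le:
  assumes "d \<ge> 2" "T \<ge> 16"
  shows "real d * ln (1 + real T / real d) \<le> 32 * (real (lb_m d T) * of_int (lb_K d T))"
proof (cases "d div 2 \<le> T div 16")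
  case True
  define m where "m = lb_m d T"
  define N where "N = T div m"
  have m: "m = d div 2" using True by (simp add: m_def lb_m_def)
  have N: "N \<ge> 16" using lb_m_bounds[OF assms] by (simp add: N_def m_def)
  have m1: "m \<ge> 1" using assms m by simp
  have "T < m * (N + 1)"
    using m1 dividend_less_times_div[of m T] by (simp add: N_def)
  then have "2 * T \<le> 2 * m * (N + 1)" by simp
  also have "\<dots> \<le> d * (N + 1)" using m by (intro mult_right_mono) auto
  finally have "2 * T \<le> d * (N + 1)" .
  then have "2 * real T \<le> real d * (real N + 1)"
    by (metis of_nat_1 of_nat_add of_nat_le_iff of_nat_mult of_nat_numeral)
  then have "2 * (real T / real d) \<le> real N + 1" using assms by (simp add: field_simps)
  with N have "1 + real T / real d \<le> real N" by linarith
  then have "ln (1 + real T / real d) \<le> ln (real N)"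
    by (intro ln_mono) (auto intro: add_pos_nonneg)
  also have "\<dots> \<le> 8 * of_int (lb_K d T)"
    using lb_K_bounds(3)[OF assms] by (simp add: N_def m_def)
  finally have "ln (1 + real T / real d) \<le> 8 * of_int (lb_K d T)" .
  moreover have "d \<le> 3 * m" using m assms by linarith
  then have "real d \<le> 3 * real m" by linarith
  ultimately have "real d * ln (1 + real T / real d) \<le> (3 * real m) * (8 * of_int (lb_K d T))"
    using assms by (intro mult_mono) auto
  moreover have "0 \<le> real m * of_int (lb_K d T)" using lb_K_bounds(1)[OF assms] by simp
  ultimately show ?thesis unfolding m_def by linarith
next
  case False
  then have m: "lb_m d T = T div 16" by (simp add: lb_m_def)
  have "16 \<le> T \<Longrightarrow> T \<le> 32 * (T div 16)" by presburger
  with assms have T: "T \<le> 32 * (T div 16)" by simp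
  have "real d * ln (1 + real T / real d) \<le> real d * (real T / real d)"
    by (intro mult_left_mono ln_add_one_self_le_self) auto
  also have "\<dots> = real T" using assms by simp
  also have "real T \<le> 32 * (real (lb_m d T) * 1)" using T unfolding m by linarith
  also have "\<dots> \<le> 32 * (real (lb_m d T) * of_int (lb_K d T))"
    using lb_K_bounds(1)[OF assms] by (intro mult_left_mono) auto
  finally show ?thesis .
qed

theorem theorem10:
  shows "\<exists>c>0. \<forall>d\<ge>2. \<forall>T\<ge>16.
    c * real d * ln (1 + real T / real d) \<le> real (lb_m d T) * of_int (lb_K d T) / 125 \<and>
    (\<forall>(M :: 'w measure) (A :: 'w alg).
       online_algorithm (prod_disc d) M A \<longrightarrow>
       (\<exists>f. (\<forall>t\<in>{1..T}. f t \<in> losses (prod_disc d)) \<and>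
            expected_alt_regret (prod_disc d) T M A f
              \<ge> real (lb_m d T) * of_int (lb_K d T) / 125 \<and>
            expected_alt_regret (prod_disc d) T M A f
              \<ge> c * real d * ln (1 + real T / real d)))"
\<comment> \<open>4000 = 32 * 125, with 32 from \<open>ln_rate_le\<close>.\<close>
proof (intro exI[of _ "1 / 4000"] conjI allI impI)
  fix d T :: nat assume dT: "d \<ge> 2" "T \<ge> 16"
  show rate: "1 / 4000 * real d * ln (1 + real T / real d)
      \<le> real (lb_m d T) * of_int (lb_K d T) / 125"
    using ln_rate_le[OF dT] by simp
  fix M :: "'w measure" and A :: "'w alg"
  assume A: "online_algorithm (prod_disc d) M A"
  interpret learner d M A using dT A by unfold_locales auto
  have "real (nat (lb_K d T)) = of_int (lb_K d T)" using lb_K_bounds(1)[OF dT] by simp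
  with regret_lower_bound[OF lb_K_bounds(2)[OF dT] lb_m_bounds(2,4)[OF dT]]
  obtain f where f: "\<forall>t\<in>{1..T}. f t \<in> losses (prod_disc d)"
    "real (lb_m d T) * of_int (lb_K d T) / 125 \<le> expected_alt_regret (prod_disc d) T M A f"
    by auto
  with order_trans[OF rate f(2)]
  show "\<exists>f. (\<forall>t\<in>{1..T}. f t \<in> losses (prod_disc d)) \<and>
      real (lb_m d T) * of_int (lb_K d T) / 125 \<le> expected_alt_regret (prod_disc d) T M A f \<and>
      1 / 4000 * real d * ln (1 + real T / real d) \<le> expected_alt_regret (prod_disc d) T M A f"
    by blast
qed simp

end
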